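(* Let $H\in\mathbb{S}^n$, let $A\in\mathbb{R}^{m\times n}$ have full row rank with $m<n$, and let $Z\in\mathbb{R}^{n\times(n-m)}$ have orthonormal columns spanning $\mathcal{N}(A)$. Let $f$, $\lambda_*$, $c$ and the finite-attainability conditions be as defined in the context. Then exactly one of the following alternatives holds. (i) (Finite exact recovery.) The finite-attainability conditions hold, or equivalently $c=0$. Then there exists $\bar\rho\ge0$ such that $f(\rho)=\lambda_*$ for every $\rho\ge\bar\rho$. (ii) (Strict asymptotic recovery.) The finite-attainability conditions fail, or equivalently $c>0$. Then $f(\rho)<\lambda_*$ for every finite $\rho$, $f$ is strictly increasing on $\mathbb{R}$, and, as $\rho\to+\infty$, $$f(\rho)\uparrow\lambda_*,\qquad \lambda_*-f(\rho)=\frac{c}{\rho}+O(\rho^{-2}).$$ In particular, if $\lambda_*=0$, either $f(\rho)=0$ for all sufficiently large $\rho$, or $f(\rho)<0$ for every finite $\rho$ and $f(\rho)=-c/\rho+O(\rho^{-2})$ as $\rho\to+\infty$ with $c>0$.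
   Context: $\mathbb{S}^n$ denotes the space of $n\times n$ real symmetric matrices, $\mathcal{N}(\cdot)$ the null space, $\lambda_{\min}(M)$ the smallest eigenvalue of a symmetric matrix $M$, and $\|\cdot\|$ the Euclidean norm. Notation: $f(\rho):=\lambda_{\min}(H+\rho A^{\mathrm T}A)$ for $\rho\in\mathbb{R}$; $\lambda_*:=\lambda_{\min}(Z^{\mathrm T}HZ)$; $\mathcal{E}_*:=\mathcal{N}(Z^{\mathrm T}HZ-\lambda_*I_{n-m})$; $K:=H-\lambda_*I_n$; and $$c:=\max_{w\in\mathcal{E}_*,\ \|w\|=1}\left\|(AA^{\mathrm T})^{-1}AHZw\right\|^2 .$$ The finite-attainability conditions are the following three mutually equivalent conditions: (a) there exists a finite $\rho^*\in\mathbb{R}$ with $f(\rho^* )=\lambda_*$; (b) $KZw=0$ for every $w\in\mathcal{E}_*$; (c) $\mathcal{N}(Z^{\mathrm T}KZ)=\mathcal{N}(Z^{\mathrm T}K^2Z)$. $f(\rho)\uparrow\lambda_*$ means convergence to $\lambda_*$ from below, nondecreasingly. *)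

theory Defs
  imports "HOL-Analysis.Analysis" "HOL-Library.Landau_Symbols"
begin

definition null_space :: "real^'q^'p \<Rightarrow> (real^'q) set" where
  "null_space M = {x. M *v x = 0}"

definition eigenvalues :: "real^'p^'p \<Rightarrow> real set" where
  "eigenvalues M = {\<mu>. \<exists>v. v \<noteq> 0 \<and> M *v v = \<mu> *\<^sub>R v}"

(* Used for symmetric M only, where the set of real eigenvalues is nonempty and contains
   all eigenvalues. *)
definition lambda_min :: "real^'p^'p \<Rightarrow> real" where
  "lambda_min M = Min (eigenvalues M)"

definition orthonormal_columns :: "real^'q^'p \<Rightarrow> bool" where
  "orthonormal_columns Z \<longleftrightarrow>
     (\<forall>i j. column i Z \<bullet> column j Z = (if i = j then 1 else 0))"

definition penalized :: "real^'n^'n \<Rightarrow> real^'n^'m \<Rightarrow> real \<Rightarrow> real" where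
  "penalized H A \<rho> = lambda_min (H + \<rho> *\<^sub>R (transpose A ** A))"

definition lambda_star :: "real^'n^'n \<Rightarrow> real^'k^'n \<Rightarrow> real" where
  "lambda_star H Z = lambda_min (transpose Z ** H ** Z)"

definition E_star :: "real^'n^'n \<Rightarrow> real^'k^'n \<Rightarrow> (real^'k) set" where
  "E_star H Z = null_space (transpose Z ** H ** Z - mat (lambda_star H Z))"

definition K_shift :: "real^'n^'n \<Rightarrow> real^'k^'n \<Rightarrow> real^'n^'n" where
  "K_shift H Z = H - mat (lambda_star H Z)"

(* GREATEST, rather than a supremum: the coefficient is a maximum. *)
definition c_coeff :: "real^'n^'n \<Rightarrow> real^'n^'m \<Rightarrow> real^'k^'n \<Rightarrow> real" where
  "c_coeff H A Z =
     (GREATEST t. \<exists>w \<in> E_star H Z. norm w = 1 \<and>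
        t = (norm ((matrix_inv (A ** transpose A) ** A ** H ** Z) *v w))\<^sup>2)"

definition attain_a :: "real^'n^'n \<Rightarrow> real^'n^'m \<Rightarrow> real^'k^'n \<Rightarrow> bool" where
  "attain_a H A Z \<longleftrightarrow> (\<exists>\<rho>. penalized H A \<rho> = lambda_star H Z)"

definition attain_b :: "real^'n^'n \<Rightarrow> real^'k^'n \<Rightarrow> bool" where
  "attain_b H Z \<longleftrightarrow> (\<forall>w \<in> E_star H Z. (K_shift H Z ** Z) *v w = 0)"

definition attain_c :: "real^'n^'n \<Rightarrow> real^'k^'n \<Rightarrow> bool" where
  "attain_c H Z \<longleftrightarrow>
     null_space (transpose Z ** K_shift H Z ** Z) =
     null_space (transpose Z ** (K_shift H Z ** K_shift H Z) ** Z)"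

definition increases_to :: "(real \<Rightarrow> real) \<Rightarrow> real \<Rightarrow> bool" where
  "increases_to f l \<longleftrightarrow> mono f \<and> (\<forall>\<rho>. f \<rho> \<le> l) \<and> (f \<longlongrightarrow> l) at_top"

end

theory Submission
  imports Defs
begin

text \<open>By Rayleigh's principle \<open>f \<rho> - \<lambda>\<close> is the minimum of \<open>x \<bullet> K x + \<rho> |A x|\<^sup>2\<close> over the unit sphere.
  Split a minimiser as \<open>x = Z (w0 + w1) + y\<close> with \<open>w0\<close> in \<open>E\<close>, \<open>w1\<close> orthogonal to \<open>E\<close>
  and \<open>y\<close> in the row space of \<open>A\<close>. The spectral gap of \<open>Z\<^sup>T K Z\<close> absorbs every term containing
  \<open>w1\<close>, and on \<open>E\<close> one has \<open>K Z w0 = A\<^sup>T u\<close> with \<open>|u|\<^sup>2 \<le> c\<close>, so completing a square gives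
  \<open>\<lambda> - f \<rho> \<le> c / (\<rho> - M)\<close> for a constant \<open>M\<close>. For \<open>c = 0\<close> this is exact recovery; for \<open>c > 0\<close>
  a first-order trial vector supplies the matching bound from the other side. A minimiser for
  \<open>f \<rho> < \<lambda>\<close> is not in the kernel of \<open>A\<close>, which makes \<open>f\<close> strictly increasing.\<close>

section \<open>Quadratic forms and smallest eigenvalues of symmetric matrices\<close>

lemma inner_transpose_mult:
  fixes M :: "real^'q^'p"
  shows "(transpose M *v x) \<bullet> y = x \<bullet> (M *v y)"
  by (simp add: dot_lmul_matrix)

lemma symmetric_inner_mult:
  fixes M :: "real^'p^'p"
  assumes "transpose M = M"
  shows "(M *v x) \<bullet> y = x \<bullet> (M *v y)"
  using inner_transpose_mult[of M x y] assms by simp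

lemma mat_mult_vec:
  fixes x :: "real^'p"
  shows "mat a *v x = a *\<^sub>R x"
proof -
  have "mat a = a *\<^sub>R (mat 1 :: real^'p^'p)"
    by (simp add: mat_def vec_eq_iff)
  then show ?thesis
    by (metis matrix_vector_mul_lid scaleR_matrix_vector_assoc)
qed

lemma subspace_null_space: "subspace (null_space M)"
  unfolding null_space_def subspace_def
  by (auto simp: matrix_vector_right_distrib matrix_vector_mult_scaleR)

text \<open>Moving from \<open>v\<close> along \<open>- N *v v\<close> lowers the form at first
  order, and a form that is already zero cannot drop further.\<close>

lemma psd_inner_zero_imp_kernel:
  fixes N :: "real^'p^'p"
  assumes sym: "transpose N = N" and psd: "\<And>x. 0 \<le> x \<bullet> (N *v x)"
    and v: "v \<bullet> (N *v v) = 0"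
  shows "N *v v = 0"
proof -
  define z where "z = N *v v"
  define b where "b = z \<bullet> (N *v z)"
  have b: "b \<ge> 0" using psd by (simp add: b_def)
  have *: "2 * s * (z \<bullet> z) \<le> s\<^sup>2 * b" for s
  proof -
    have "v \<bullet> (N *v z) = z \<bullet> z"
      using symmetric_inner_mult[OF sym, of v z] by (simp add: z_def)
    then have "(v - s *\<^sub>R z) \<bullet> (N *v (v - s *\<^sub>R z)) = s\<^sup>2 * b - 2 * s * (z \<bullet> z)"
      using v by (simp add: matrix_vector_mult_diff_distrib matrix_vector_mult_scaleR
          inner_diff_left inner_diff_right b_def power2_eq_square right_diff_distrib flip: z_def)
    then show ?thesis using psd[of "v - s *\<^sub>R z"] by simp
  qed
  have "z \<bullet> z = 0"
  proof (rule ccontr)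
    assume "z \<bullet> z \<noteq> 0"
    then have p: "z \<bullet> z > 0" by simp
    \<comment> \<open>A step small enough for the linear term to beat \<open>s * (s * b)\<close>;
      the \<open>+ 1\<close> covers \<open>b = 0\<close>.\<close>
    define s where "s = (z \<bullet> z) / (b + 1)"
    have s: "s > 0" using p b by (simp add: s_def)
    have "2 * s * (z \<bullet> z) \<le> s * (s * b)" using *[of s] by (simp add: power2_eq_square)
    then have "2 * (z \<bullet> z) \<le> s * b" using s by simp
    also have "s * b \<le> s * (b + 1)" using s by simp
    also have "\<dots> = z \<bullet> z" using b by (simp add: s_def)
    finally show False using p by simp
  qed
  then show ?thesis by (simp add: z_def)
qed

text \<open>The unit sphere of \<open>V\<close> is compact and nonempty (normalise
  \<open>x0\<close>); homogeneity of degree two carries its minimum to all of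
  \<open>V\<close>.\<close>

lemma quadratic_form_attains_min_on_subspace:
  fixes M :: "real^'p^'p"
  assumes V: "subspace V" and x0: "x0 \<in> V" "x0 \<noteq> 0"
  obtains v where "v \<in> V" "norm v = 1"
    and "\<And>x. x \<in> V \<Longrightarrow> (v \<bullet> (M *v v)) * (norm x)\<^sup>2 \<le> x \<bullet> (M *v x)"
proof -
  let ?C = "V \<inter> sphere 0 1"
  have "compact ?C"
    by (metis V closed_subspace compact_sphere closed_Int_compact)
  moreover have "x0 /\<^sub>R norm x0 \<in> ?C"
    using V x0 by (simp add: subspace_scale)
  moreover have "continuous_on ?C (\<lambda>x. x \<bullet> (M *v x))"
    by (intro continuous_intros linear_continuous_on linear_linear[THEN iffD2]
        linear_conv_bounded_linear[THEN iffD1] matrix_vector_mul_linear)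
  ultimately obtain v where v: "v \<in> ?C"
    and min: "\<And>x. x \<in> ?C \<Longrightarrow> v \<bullet> (M *v v) \<le> x \<bullet> (M *v x)"
    using continuous_attains_inf[of ?C "\<lambda>x. x \<bullet> (M *v x)"] by blast
  show thesis
  proof
    fix x assume x: "x \<in> V"
    show "(v \<bullet> (M *v v)) * (norm x)\<^sup>2 \<le> x \<bullet> (M *v x)"
    proof (cases "x = 0")
      case False
      have "v \<bullet> (M *v v) \<le> (x /\<^sub>R norm x) \<bullet> (M *v (x /\<^sub>R norm x))"
        using V x False by (intro min) (simp add: subspace_scale)
      also have "\<dots> = x \<bullet> (M *v x) / (norm x)\<^sup>2"
        by (simp add: matrix_vector_mult_scaleR power2_eq_square field_simps)
      finally show ?thesis using False by (simp add: field_simps)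
    qed simp
  qed (use v in auto)
qed

text \<open>Eigenvectors of distinct eigenvalues are orthogonal, and a pairwise orthogonal set is
  finite. This gives the \<open>Min\<close> in \<open>lambda_min\<close> its meaning.\<close>

lemma finite_eigenvalues:
  fixes M :: "real^'p^'p"
  assumes sym: "transpose M = M"
  shows "finite (eigenvalues M)"
proof -
  have "\<forall>\<mu> \<in> eigenvalues M. \<exists>v. v \<noteq> 0 \<and> M *v v = \<mu> *\<^sub>R v"
    by (simp add: eigenvalues_def)
  from bchoice[OF this] obtain v where
    v: "\<And>\<mu>. \<mu> \<in> eigenvalues M \<Longrightarrow> v \<mu> \<noteq> 0 \<and> M *v v \<mu> = \<mu> *\<^sub>R v \<mu>"
    by blast
  have orth: "v a \<bullet> v b = 0" if "a \<in> eigenvalues M" "b \<in> eigenvalues M" "a \<noteq> b" for a b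
  proof -
    have "a * (v a \<bullet> v b) = b * (v a \<bullet> v b)"
      using symmetric_inner_mult[OF sym, of "v a" "v b"] v that by simp
    then show ?thesis using that by simp
  qed
  have "pairwise orthogonal (v ` eigenvalues M)"
    unfolding pairwise_def orthogonal_def using orth by blast
  then have "finite (v ` eigenvalues M)" by (rule pairwise_orthogonal_imp_finite)
  moreover have "inj_on v (eigenvalues M)"
  proof (rule inj_onI, rule ccontr)
    fix a b assume ab: "a \<in> eigenvalues M" "b \<in> eigenvalues M" "v a = v b" "a \<noteq> b"
    have "v a \<bullet> v b = 0" using orth ab by blast
    then show False using ab v[of b] by simp
  qed
  ultimately show ?thesis by (rule finite_imageD)
qed

text \<open>Rayleigh's principle. With \<mu> the minimum of the form on the sphere,
  \<open>M - mat \<mu>\<close> is positive semidefinite and its form vanishes at the minimiser,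
  which is therefore an eigenvector.\<close>

lemma lambda_min_attained:
  fixes M :: "real^'p^'p"
  assumes sym: "transpose M = M"
  obtains v where "norm v = 1" "M *v v = lambda_min M *\<^sub>R v"
    and "\<And>x. lambda_min M * (norm x)\<^sup>2 \<le> x \<bullet> (M *v x)"
proof -
  obtain v where v: "norm v = 1"
    and min: "\<And>x. (v \<bullet> (M *v v)) * (norm x)\<^sup>2 \<le> x \<bullet> (M *v x)"
    by (rule quadratic_form_attains_min_on_subspace[where V = UNIV and M = M and ?x0.0 = "axis undefined 1"])
      auto
  define \<mu> where "\<mu> = v \<bullet> (M *v v)"
  have "transpose (M - mat \<mu>) = M - mat \<mu>"
    using sym by (simp add: transpose_def mat_def vec_eq_iff)
  moreover have "0 \<le> x \<bullet> ((M - mat \<mu>) *v x)" for x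
    using min[of x] by (simp add: matrix_vector_mult_diff_rdistrib mat_mult_vec
        inner_diff_right dot_square_norm flip: \<mu>_def)
  moreover have "v \<bullet> ((M - mat \<mu>) *v v) = 0"
    using v by (simp add: matrix_vector_mult_diff_rdistrib mat_mult_vec
        inner_diff_right dot_square_norm \<mu>_def)
  ultimately have "(M - mat \<mu>) *v v = 0" by (rule psd_inner_zero_imp_kernel)
  then have ev: "M *v v = \<mu> *\<^sub>R v" by (simp add: matrix_vector_mult_diff_rdistrib mat_mult_vec)
  have "lambda_min M = \<mu>"
    unfolding lambda_min_def
  proof (rule Min_eqI[OF finite_eigenvalues[OF sym]])
    show "\<mu> \<in> eigenvalues M"
      using ev v unfolding eigenvalues_def by (metis (mono_tags, lifting) mem_Collect_eq norm_zero zero_neq_one)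
  next
    fix \<nu> assume "\<nu> \<in> eigenvalues M"
    then obtain x where "x \<noteq> 0" "M *v x = \<nu> *\<^sub>R x" by (auto simp: eigenvalues_def)
    then show "\<mu> \<le> \<nu>" using min[of x] by (simp add: dot_square_norm flip: \<mu>_def)
  qed
  then show thesis using that v ev min \<mu>_def by metis
qed

text \<open>The minimum on the unit sphere of the kernel's orthogonal complement is attained; if it
  were zero, the minimiser would lie in the kernel as well and be orthogonal to itself.\<close>

lemma psd_spectral_gap:
  fixes N :: "real^'p^'p"
  assumes sym: "transpose N = N" and psd: "\<And>x. 0 \<le> x \<bullet> (N *v x)"
  obtains \<gamma> where "\<gamma> > 0"
    and "\<And>x. (\<And>y. y \<in> null_space N \<Longrightarrow> orthogonal x y) \<Longrightarrow> \<gamma> * (norm x)\<^sup>2 \<le> x \<bullet> (N *v x)"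
proof -
  define V where "V = {x. \<forall>y \<in> null_space N. orthogonal y x}"
  have V: "subspace V" unfolding V_def by (rule subspace_orthogonal_to_vectors)
  show thesis
  proof (cases "V \<subseteq> {0}")
    case True
    \<comment> \<open>The complement is trivial here, so any positive constant serves.\<close>
    show thesis
    proof (rule that[of 1])
      fix x :: "real^'p" assume "\<And>y. y \<in> null_space N \<Longrightarrow> orthogonal x y"
      then have "x \<in> V" by (auto simp: V_def orthogonal_commute)
      then show "1 * (norm x)\<^sup>2 \<le> x \<bullet> (N *v x)" using True by auto
    qed simp
  next
    case False
    then obtain x0 where "x0 \<in> V" "x0 \<noteq> 0" by blast
    then obtain v where v: "v \<in> V" "norm v = 1"
      and min: "\<And>x. x \<in> V \<Longrightarrow> (v \<bullet> (N *v v)) * (norm x)\<^sup>2 \<le> x \<bullet> (N *v x)"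
      using quadratic_form_attains_min_on_subspace[OF V] by metis
    show thesis
    proof (rule that)
      have "v \<bullet> (N *v v) \<noteq> 0"
      proof
        assume "v \<bullet> (N *v v) = 0"
        then have "v \<in> null_space N"
          using psd_inner_zero_imp_kernel[OF sym psd] by (simp add: null_space_def)
        then have "v \<bullet> v = 0" using v by (auto simp: V_def orthogonal_def)
        then show False using v by auto
      qed
      then show "0 < v \<bullet> (N *v v)" using psd[of v] by simp
    next
      fix x assume "\<And>y. y \<in> null_space N \<Longrightarrow> orthogonal x y"
      then have "x \<in> V" by (auto simp: V_def orthogonal_commute)
      then show "(v \<bullet> (N *v v)) * (norm x)\<^sup>2 \<le> x \<bullet> (N *v x)" by (rule min)
    qed
  qed
qed

text \<open>Full row rank makes \<open>transpose A\<close> injective, and a kernel vector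
  \<open>u\<close> of the Gram matrix has \<open>transpose A *v u\<close> of norm zero.\<close>

lemma gram_mult_matrix_inv:
  fixes A :: "real^'n^'m"
  assumes "rank A = CARD('m)"
  shows "(A ** transpose A) ** matrix_inv (A ** transpose A) = mat 1"
proof -
  have inj: "inj ((*v) (transpose A))"
    using assms by (simp add: rank_transpose flip: full_rank_injective)
  have "u = 0" if "(A ** transpose A) *v u = 0" for u
  proof -
    have "(transpose A *v u) \<bullet> (transpose A *v u) = 0"
      using that by (simp only: inner_transpose_mult matrix_vector_mul_assoc) simp
    then have "transpose A *v u = transpose A *v 0" by (simp only: inner_eq_zero_iff) simp
    then show ?thesis using inj by (rule injD[rotated])
  qed
  then have "invertible (A ** transpose A)"
    by (auto simp: invertible_left_inverse matrix_left_invertible_ker)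
  then show ?thesis
    unfolding invertible_def matrix_inv_def by (rule someI2_ex) blast
qed

section \<open>The reduced matrix on the kernel of \<open>A\<close> and the Lagrange
  multipliers\<close>

locale penalized_eigenproblem =
  fixes H :: "real^'n^'n" and A :: "real^'n^'m" and Z :: "real^'k^'n"
  assumes sym: "transpose H = H"
    and full_row_rank: "rank A = CARD('m)"
    and Z_orth: "orthonormal_columns Z"
    and Z_span: "span (columns Z) = null_space A"
begin

abbreviation "f \<equiv> penalized H A"
abbreviation "lam \<equiv> lambda_star H Z"
abbreviation "c \<equiv> c_coeff H A Z"
abbreviation "E \<equiv> E_star H Z"
abbreviation "K \<equiv> K_shift H Z"

text \<open>Since \<open>Z\<close> has orthonormal columns, this is the reduced matrix shifted by
  \<open>lam\<close>: positive semidefinite with kernel \<open>E\<close>.\<close>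

definition "S = transpose Z ** K ** Z"
definition "C = matrix_inv (A ** transpose A) ** A ** H ** Z"
text \<open>The pseudoinverse of \<open>A\<close>: a right inverse with values in the row space, so
  that \<open>T ** A\<close> projects orthogonally onto that space.\<close>

definition "T = transpose A ** matrix_inv (A ** transpose A)"

lemma transpose_K: "transpose K = K"
  using sym by (simp add: K_shift_def transpose_def mat_def vec_eq_iff)

lemma K_mult: "K *v x = H *v x - lam *\<^sub>R x"
  by (simp add: K_shift_def matrix_vector_mult_diff_rdistrib mat_mult_vec)

lemma Z_gram: "transpose Z ** Z = mat 1"
  using Z_orth
  by (simp add: orthonormal_columns_def matrix_mult_transpose_dot_column mat_def vec_eq_iff)

lemma inner_Z: "(Z *v v) \<bullet> (Z *v w) = v \<bullet> w"
proof -
  have "(Z *v v) \<bullet> (Z *v w) = (transpose Z *v (Z *v v)) \<bullet> w"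
    by (rule inner_transpose_mult[symmetric])
  then show ?thesis by (simp only: matrix_vector_mul_assoc Z_gram matrix_vector_mul_lid)
qed

lemma norm_Z: "norm (Z *v w) = norm w"
  by (simp add: norm_eq_sqrt_inner inner_Z)

lemma A_Z [simp]: "A *v (Z *v w) = 0"
  using matrix_vector_mult_in_columnspace[of Z w] Z_span by (simp add: null_space_def)

lemma kernel_A:
  assumes "A *v x = 0"
  obtains w where "x = Z *v w"
proof -
  have "columns Z \<subseteq> range ((*v) Z)"
    by (auto simp: columns_def simp flip: matrix_vector_mult_basis)
  moreover have "subspace (range ((*v) Z))"
    by (intro subspace_UNIV linear_subspace_image matrix_vector_mul_linear)
  ultimately have "span (columns Z) \<subseteq> range ((*v) Z)" by (rule span_minimal)
  then show thesis using assms that Z_span by (auto simp: null_space_def)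
qed

lemma T_mult: "T *v u = transpose A *v (matrix_inv (A ** transpose A) *v u)"
  unfolding T_def by (simp only: matrix_vector_mul_assoc)

lemma A_T [simp]: "A *v (T *v u) = u"
  unfolding T_def using gram_mult_matrix_inv[OF full_row_rank]
  by (simp only: matrix_vector_mul_assoc matrix_mul_assoc matrix_vector_mul_lid)

lemma inner_T_Z: "(T *v u) \<bullet> (Z *v w) = 0"
  unfolding T_mult inner_transpose_mult by simp

lemma transpose_S: "transpose S = S"
  unfolding S_def by (simp add: matrix_transpose_mul transpose_K matrix_mul_assoc)

lemma inner_S: "v \<bullet> (S *v w) = (Z *v v) \<bullet> (K *v (Z *v w))"
proof -
  have "v \<bullet> (S *v w) = v \<bullet> (transpose Z *v (K *v (Z *v w)))"
    unfolding S_def by (simp only: matrix_vector_mul_assoc matrix_mul_assoc)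
  also have "\<dots> = (Z *v v) \<bullet> (K *v (Z *v w))"
    using inner_transpose_mult[of Z "K *v (Z *v w)" v] by (simp only: inner_commute)
  finally show ?thesis .
qed

lemma S_mult: "S *v w = (transpose Z ** H ** Z) *v w - lam *\<^sub>R w"
proof -
  have "S *v w = transpose Z *v (K *v (Z *v w))"
    unfolding S_def by (simp only: matrix_vector_mul_assoc matrix_mul_assoc)
  also have "\<dots> = transpose Z *v (H *v (Z *v w)) - lam *\<^sub>R (transpose Z *v (Z *v w))"
    by (simp only: K_mult matrix_vector_mult_diff_distrib matrix_vector_mult_scaleR)
  also have "\<dots> = (transpose Z ** H ** Z) *v w - lam *\<^sub>R w"
    by (simp only: matrix_vector_mul_assoc matrix_mul_assoc Z_gram matrix_vector_mul_lid)
  finally show ?thesis .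
qed

lemma E_eq: "E = null_space S"
  by (simp add: E_star_def null_space_def S_mult matrix_vector_mult_diff_rdistrib mat_mult_vec)

lemma transpose_ZHZ: "transpose (transpose Z ** H ** Z) = transpose Z ** H ** Z"
  by (simp add: matrix_transpose_mul sym matrix_mul_assoc)

lemma S_psd: "0 \<le> w \<bullet> (S *v w)"
proof -
  obtain v where "norm v = 1" "(transpose Z ** H ** Z) *v v = lam *\<^sub>R v"
    and "\<And>x. lam * (norm x)\<^sup>2 \<le> x \<bullet> ((transpose Z ** H ** Z) *v x)"
    unfolding lambda_star_def using lambda_min_attained[OF transpose_ZHZ] by metis
  then show ?thesis by (simp add: S_mult inner_diff_right dot_square_norm)
qed

lemma E_nontrivial: obtains w where "w \<in> E" "norm w = 1"
proof -
  obtain v where "norm v = 1" "(transpose Z ** H ** Z) *v v = lam *\<^sub>R v"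
    unfolding lambda_star_def using lambda_min_attained[OF transpose_ZHZ] by metis
  then show thesis using that by (simp add: E_eq null_space_def S_mult)
qed

text \<open>\<open>H\<close> may be replaced by \<open>K\<close> because \<open>A\<close>
  annihilates the range of \<open>Z\<close>.\<close>

lemma C_mult: "C *v w = matrix_inv (A ** transpose A) *v (A *v (K *v (Z *v w)))"
proof -
  have "A *v (K *v (Z *v w)) = A *v (H *v (Z *v w))"
    by (simp add: K_mult matrix_vector_mult_diff_distrib matrix_vector_mult_scaleR)
  then show ?thesis unfolding C_def by (simp only: matrix_vector_mul_assoc matrix_mul_assoc)
qed

text \<open>For a vector of \<open>E\<close> the stationarity condition of the constrained problem says that
  \<open>C *v w\<close> is its Lagrange multiplier.\<close>

lemma K_Z_on_E:
  assumes "w \<in> E"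
  shows "K *v (Z *v w) = transpose A *v (C *v w)"
proof -
  define g where "g = K *v (Z *v w)"
  \<comment> \<open>The component of \<open>g\<close> in the kernel of \<open>A\<close>. Being
    orthogonal to \<open>g\<close> and to the row space, it is orthogonal to itself and
    vanishes.\<close>
  define r where "r = g - T *v (A *v g)"
  have "A *v r = 0" by (simp add: r_def matrix_vector_mult_diff_distrib)
  then obtain v where v: "r = Z *v v" by (rule kernel_A)
  have "r \<bullet> g = v \<bullet> (S *v w)" by (simp add: v inner_S g_def)
  then have "r \<bullet> g = 0" using assms by (simp add: E_eq null_space_def)
  moreover have "r \<bullet> (T *v (A *v g)) = 0" using inner_T_Z v by (simp add: inner_commute)
  ultimately have "r \<bullet> (g - T *v (A *v g)) = 0" by (simp only: inner_diff_right)
  then have "g = T *v (A *v g)" by (simp flip: r_def) (simp add: r_def)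
  then show ?thesis by (simp only: C_mult T_mult flip: g_def)
qed

lemma C_eq_0_iff:
  assumes "w \<in> E"
  shows "C *v w = 0 \<longleftrightarrow> K *v (Z *v w) = 0"
  using K_Z_on_E[OF assms] C_mult[of w] by auto

section \<open>The coefficient \<open>c\<close> and the attainability conditions (b) and (c)\<close>

text \<open>Compactness makes the \<open>GREATEST\<close> in \<open>c_coeff\<close> a genuine
  maximum; homogeneity extends the bound from unit vectors to all of \<open>E\<close>.\<close>

lemma c_attained:
  obtains w where "w \<in> E" "norm w = 1" "c = (norm (C *v w))\<^sup>2"
    and "\<And>v. v \<in> E \<Longrightarrow> (norm (C *v v))\<^sup>2 \<le> c * (norm v)\<^sup>2"
proof -
  \<comment> \<open>The sign turns the maximum into a minimum of a quadratic form.\<close>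
  define M where "M = (-1) *\<^sub>R (transpose C ** C)"
  have M: "x \<bullet> (M *v x) = - (norm (C *v x))\<^sup>2" for x
  proof -
    have "M *v x = (-1) *\<^sub>R (transpose C *v (C *v x))"
      unfolding M_def by (simp only: matrix_vector_mul_assoc scaleR_matrix_vector_assoc[symmetric])
    then show ?thesis
      using inner_transpose_mult[of C "C *v x" x]
      by (simp only: inner_scaleR_right inner_commute[of x] dot_square_norm)
  qed
  obtain x0 where x0: "x0 \<in> E" "norm x0 = 1" by (rule E_nontrivial)
  then have "x0 \<noteq> 0" by auto
  moreover have "subspace E" unfolding E_eq by (rule subspace_null_space)
  ultimately obtain w where w: "w \<in> E" "norm w = 1"
    and min: "\<And>x. x \<in> E \<Longrightarrow> (w \<bullet> (M *v w)) * (norm x)\<^sup>2 \<le> x \<bullet> (M *v x)"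
    using quadratic_form_attains_min_on_subspace[of E x0 M] x0(1) by metis
  have max: "(norm (C *v x))\<^sup>2 \<le> (norm (C *v w))\<^sup>2 * (norm x)\<^sup>2" if "x \<in> E" for x
    using min[OF that] by (simp add: M)
  have "c = (norm (C *v w))\<^sup>2"
    unfolding c_coeff_def C_def[symmetric]
  proof (rule Greatest_equality)
    show "\<exists>v\<in>E. norm v = 1 \<and> (norm (C *v w))\<^sup>2 = (norm (C *v v))\<^sup>2" using w by blast
  next
    fix t assume "\<exists>v\<in>E. norm v = 1 \<and> t = (norm (C *v v))\<^sup>2"
    then obtain v where "v \<in> E" "norm v = 1" "t = (norm (C *v v))\<^sup>2" by blast
    then show "t \<le> (norm (C *v w))\<^sup>2" using max[of v] by simp
  qed
  then show thesis using that w max by metis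
qed

lemma c_nonneg: "0 \<le> c"
  by (rule c_attained) simp

lemma attain_b_iff_c_eq_0: "attain_b H Z \<longleftrightarrow> c = 0"
proof
  assume b: "attain_b H Z"
  obtain w where "w \<in> E" "c = (norm (C *v w))\<^sup>2" by (rule c_attained)
  moreover have "K *v (Z *v w) = 0" if "w \<in> E" for w
    using b that unfolding attain_b_def by (simp only: matrix_vector_mul_assoc)
  ultimately show "c = 0" using C_eq_0_iff by simp
next
  assume 0: "c = 0"
  have "C *v w = 0" if "w \<in> E" for w
    by (rule c_attained) (use that 0 in fastforce)
  then show "attain_b H Z"
    unfolding attain_b_def using C_eq_0_iff by (simp only: matrix_vector_mul_assoc[symmetric]) blast
qed

text \<open>Pairing \<open>Z\<^sup>T K\<^sup>2 Z w\<close> with \<open>w\<close> gives the squared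
  norm of \<open>K Z w\<close>. So the right-hand null space in (c) is the set where
  \<open>K Z w\<close> vanishes, always a subset of \<open>E\<close>, and (c) says that it is all of
  \<open>E\<close>.\<close>

lemma attain_b_iff_attain_c: "attain_b H Z \<longleftrightarrow> attain_c H Z"
proof -
  have N2: "null_space (transpose Z ** (K ** K) ** Z) = {w. K *v (Z *v w) = 0}"
  proof -
    have eq: "(transpose Z ** (K ** K) ** Z) *v w = transpose Z *v (K *v (K *v (Z *v w)))" for w
      by (simp only: matrix_vector_mul_assoc matrix_mul_assoc)
    have "K *v (Z *v w) = 0" if "transpose Z *v (K *v (K *v (Z *v w))) = 0" for w
    proof -
      have "0 = (K *v (K *v (Z *v w))) \<bullet> (Z *v w)"
        using inner_transpose_mult[of Z "K *v (K *v (Z *v w))" w] that by (simp only: inner_zero_left)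
      also have "\<dots> = (K *v (Z *v w)) \<bullet> (K *v (Z *v w))"
        by (rule symmetric_inner_mult[OF transpose_K])
      finally show ?thesis by simp
    qed
    then show ?thesis
      unfolding null_space_def by (auto simp: eq simp del: transpose_matrix_vector)
  qed
  have "w \<in> E" if "K *v (Z *v w) = 0" for w
    unfolding E_eq null_space_def S_def using that
    by (simp add: matrix_vector_mul_assoc[symmetric] del: transpose_matrix_vector)
  then show ?thesis
    unfolding attain_b_def attain_c_def N2 S_def[symmetric] E_eq[symmetric]
    by (auto simp: matrix_vector_mul_assoc[symmetric])
qed

section \<open>Variational description, monotonicity and attainment of \<open>f\<close>\<close>

lemma penalized_form:
  "x \<bullet> ((H + \<rho> *\<^sub>R (transpose A ** A)) *v x) =
    x \<bullet> (K *v x) + lam * (norm x)\<^sup>2 + \<rho> * (norm (A *v x))\<^sup>2"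
proof -
  have "(H + \<rho> *\<^sub>R (transpose A ** A)) *v x = K *v x + lam *\<^sub>R x + \<rho> *\<^sub>R (transpose A *v (A *v x))"
    by (simp only: matrix_vector_mult_add_rdistrib K_mult scaleR_matrix_vector_assoc[symmetric]
        matrix_vector_mul_assoc) simp
  moreover have "x \<bullet> (transpose A *v (A *v x)) = (norm (A *v x))\<^sup>2"
    using inner_transpose_mult[of A "A *v x" x] by (simp only: inner_commute[of x] dot_square_norm)
  ultimately show ?thesis
    by (simp only: inner_add_right inner_scaleR_right dot_square_norm)
qed

lemma penalized_attained:
  obtains x where "norm x = 1" "f \<rho> - lam = x \<bullet> (K *v x) + \<rho> * (norm (A *v x))\<^sup>2"
    and "\<And>x. (f \<rho> - lam) * (norm x)\<^sup>2 \<le> x \<bullet> (K *v x) + \<rho> * (norm (A *v x))\<^sup>2"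
proof -
  let ?P = "H + \<rho> *\<^sub>R (transpose A ** A)"
  have "transpose ?P = transpose H + \<rho> *\<^sub>R transpose (transpose A ** A)"
    by (simp add: transpose_def vec_eq_iff)
  then have P: "transpose ?P = ?P"
    by (simp add: sym matrix_transpose_mul)
  obtain x where x: "norm x = 1" "?P *v x = f \<rho> *\<^sub>R x"
    and min: "\<And>x. f \<rho> * (norm x)\<^sup>2 \<le> x \<bullet> (?P *v x)"
    unfolding penalized_def using lambda_min_attained[OF P] by metis
  have "f \<rho> = x \<bullet> (?P *v x)" using x by (simp add: dot_square_norm)
  then have "f \<rho> - lam = x \<bullet> (K *v x) + \<rho> * (norm (A *v x))\<^sup>2"
    unfolding penalized_form using x(1) by simp
  moreover have "(f \<rho> - lam) * (norm x)\<^sup>2 \<le> x \<bullet> (K *v x) + \<rho> * (norm (A *v x))\<^sup>2" for x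
    using min[of x] unfolding penalized_form by (simp add: algebra_simps)
  ultimately show thesis using that x(1) by metis
qed

lemma penalized_le:
  "(f \<rho> - lam) * (norm x)\<^sup>2 \<le> x \<bullet> (K *v x) + \<rho> * (norm (A *v x))\<^sup>2"
  by (rule penalized_attained) blast

lemma K_form_on_E:
  assumes "w \<in> E"
  shows "(Z *v w) \<bullet> (K *v (Z *v w)) = 0"
  using assms inner_S[of w w] by (simp add: E_eq null_space_def)

text \<open>At the trial vector \<open>Z *v w\<close> with \<open>w\<close> a unit vector of
  \<open>E\<close>, both the \<open>K\<close>-form and the penalty vanish.\<close>

lemma penalized_le_lam: "f \<rho> \<le> lam"
proof -
  obtain w where "w \<in> E" "norm w = 1" by (rule E_nontrivial)
  then show ?thesis using penalized_le[of \<rho> "Z *v w"] by (simp add: K_form_on_E norm_Z)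
qed

text \<open>A minimiser for the larger parameter serves as trial vector for the smaller one.\<close>

lemma mono_penalized: "mono f"
proof
  fix \<rho> \<rho>' :: real assume le: "\<rho> \<le> \<rho>'"
  obtain x where x: "norm x = 1" "f \<rho>' - lam = x \<bullet> (K *v x) + \<rho>' * (norm (A *v x))\<^sup>2"
    by (rule penalized_attained)
  have "\<rho> * (norm (A *v x))\<^sup>2 \<le> \<rho>' * (norm (A *v x))\<^sup>2" using le by (rule mult_right_mono) simp
  then show "f \<rho> \<le> f \<rho>'" using penalized_le[of \<rho> x] x by simp
qed

text \<open>On the kernel of \<open>A\<close> the \<open>K\<close>-form is nonnegative, so a
  minimiser with value below \<open>lam\<close> has a nonzero penalty, which grows strictly with
  \<rho>.\<close>

lemma strict_mono_penalized:
  assumes "\<And>\<rho>. f \<rho> < lam"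
  shows "strict_mono f"
proof
  fix \<rho> \<rho>' :: real assume less: "\<rho> < \<rho>'"
  obtain x where x: "norm x = 1" "f \<rho>' - lam = x \<bullet> (K *v x) + \<rho>' * (norm (A *v x))\<^sup>2"
    by (rule penalized_attained)
  have "A *v x \<noteq> 0"
  proof
    assume 0: "A *v x = 0"
    then obtain w where "x = Z *v w" by (rule kernel_A)
    then have "0 \<le> x \<bullet> (K *v x)" using S_psd[of w] by (simp add: inner_S)
    then show False using x(2) 0 assms[of \<rho>'] by simp
  qed
  then have "\<rho> * (norm (A *v x))\<^sup>2 < \<rho>' * (norm (A *v x))\<^sup>2" using less by simp
  then show "f \<rho> < f \<rho>'" using penalized_le[of \<rho> x] x by simp
qed

text \<open>Equality makes \<open>K + \<rho> *\<^sub>R (transpose A ** A)\<close> positive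
  semidefinite. Its form vanishes at \<open>Z *v w\<close> for \<open>w\<close> in \<open>E\<close>,
  so the matrix annihilates that vector; the penalty part contributes nothing, leaving
  \<open>K\<close>.\<close>

lemma attain_a_imp_attain_b:
  assumes "attain_a H A Z"
  shows "attain_b H Z"
proof -
  obtain \<rho> where \<rho>: "f \<rho> = lam" using assms by (auto simp: attain_a_def)
  let ?N = "K + \<rho> *\<^sub>R (transpose A ** A)"
  have "transpose ?N = transpose K + \<rho> *\<^sub>R transpose (transpose A ** A)"
    by (simp add: transpose_def vec_eq_iff)
  then have N: "transpose ?N = ?N"
    by (simp add: transpose_K matrix_transpose_mul)
  have mult: "?N *v x = K *v x + \<rho> *\<^sub>R (transpose A *v (A *v x))" for x
    by (simp only: matrix_vector_mult_add_rdistrib scaleR_matrix_vector_assoc[symmetric]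
        matrix_vector_mul_assoc)
  have form: "x \<bullet> (?N *v x) = x \<bullet> (K *v x) + \<rho> * (norm (A *v x))\<^sup>2" for x
    using inner_transpose_mult[of A "A *v x" x]
    by (simp only: mult inner_add_right inner_scaleR_right inner_commute[of x "transpose A *v _"] dot_square_norm)
  have "K *v (Z *v w) = 0" if "w \<in> E" for w
  proof -
    have "?N *v (Z *v w) = 0"
    proof (rule psd_inner_zero_imp_kernel[OF N])
      show "0 \<le> x \<bullet> (?N *v x)" for x
        unfolding form using penalized_le[of \<rho> x] \<rho> by simp
      show "(Z *v w) \<bullet> (?N *v (Z *v w)) = 0"
        unfolding form using K_form_on_E[OF that] by simp
    qed
    then show ?thesis by (simp add: mult)
  qed
  then show ?thesis by (simp add: attain_b_def flip: matrix_vector_mul_assoc)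
qed

section \<open>Two-sided bounds on \<open>lam - f \<rho>\<close> and exact recovery\<close>

lemma penalized_lower_bound:
  obtains M where "M > 0" "\<And>\<rho>. M < \<rho> \<Longrightarrow> lam - f \<rho> \<le> c / (\<rho> - M)"
proof -
  obtain \<gamma> where \<gamma>: "\<gamma> > 0"
    and gap: "\<And>x. (\<And>y. y \<in> null_space S \<Longrightarrow> orthogonal x y) \<Longrightarrow> \<gamma> * (norm x)\<^sup>2 \<le> x \<bullet> (S *v x)"
    using psd_spectral_gap[OF transpose_S S_psd] by metis
  obtain \<kappa> where \<kappa>: "\<kappa> > 0" "\<And>x. norm (K *v x) \<le> \<kappa> * norm x"
    using linear_bounded_pos[OF matrix_vector_mul_linear] by metis
  obtain L where L: "L > 0" "\<And>x. norm (T *v x) \<le> L * norm x"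
    using linear_bounded_pos[OF matrix_vector_mul_linear] by metis
  \<comment> \<open>The penalty weight that pays for the \<open>K\<close>-form of \<open>y\<close>
    (first summand) and for the coupling of \<open>y\<close> with \<open>Z *v w1\<close> after
    completing a square against the gap (second summand).\<close>
  define M where "M = \<kappa> * L\<^sup>2 + (L * \<kappa>)\<^sup>2 / \<gamma>"
  show thesis
  proof (rule that)
    show "M > 0" using \<gamma> \<kappa> L by (simp add: M_def add_pos_pos)
  next
    fix \<rho> assume \<rho>: "M < \<rho>"
    obtain x where x: "norm x = 1" "f \<rho> - lam = x \<bullet> (K *v x) + \<rho> * (norm (A *v x))\<^sup>2"
      by (rule penalized_attained)
    \<comment> \<open>The row-space component of the minimiser; the rest lies in the range of
      \<open>Z\<close> and is split along \<open>E\<close> and its complement.\<close>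
    define y where "y = T *v (A *v x)"
    have "A *v (x - y) = 0" by (simp add: y_def matrix_vector_mult_diff_distrib)
    then obtain w where w: "x - y = Z *v w" by (rule kernel_A)
    obtain w0 w1 where w0: "w0 \<in> span (null_space S)"
      and w1: "\<And>v. v \<in> span (null_space S) \<Longrightarrow> orthogonal w1 v" and w_eq: "w = w0 + w1"
      using orthogonal_subspace_decomp_exists[of "null_space S" w] by metis
    have E0: "w0 \<in> E" using w0 subspace_null_space[of S] by (simp add: E_eq span_eq_iff[THEN iffD2])
    have S0: "S *v w0 = 0" using E0 by (simp add: E_eq null_space_def)
    have orth: "w0 \<bullet> w1 = 0" using w1[OF w0] by (simp add: orthogonal_def inner_commute)
    have gap1: "\<gamma> * (norm w1)\<^sup>2 \<le> w1 \<bullet> (S *v w1)"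
      using w1 by (intro gap) (simp add: span_base)
    define a where "a = Z *v w0"
    define b where "b = Z *v w1"
    have x_eq: "x = a + b + y"
      using w by (simp add: a_def b_def w_eq algebra_simps)
    have Ay: "A *v y = A *v x" by (simp add: y_def)
    \<comment> \<open>Pythagoras: \<open>a\<close>, \<open>b\<close> and \<open>y\<close> are
      mutually orthogonal with sum the unit vector \<open>x\<close>.\<close>
    have norm_w0: "norm w0 \<le> 1"
    proof -
      have "y \<bullet> a = 0" "y \<bullet> b = 0" by (simp_all add: y_def a_def b_def inner_T_Z)
      moreover have "a \<bullet> b = 0" "a \<bullet> a = (norm w0)\<^sup>2"
        by (simp_all add: a_def b_def inner_Z orth norm_Z dot_square_norm)
      ultimately have "x \<bullet> x = (norm w0)\<^sup>2 + b \<bullet> b + y \<bullet> y"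
        by (simp add: x_eq inner_add_left inner_add_right inner_commute)
      moreover have "0 \<le> b \<bullet> b" "0 \<le> y \<bullet> y" "x \<bullet> x = 1" using x(1) by (simp_all add: dot_square_norm)
      ultimately have "(norm w0)\<^sup>2 \<le> 1\<^sup>2" unfolding power_one by linarith
      then show ?thesis by (rule power2_le_imp_le) simp
    qed
    define u where "u = C *v w0"
    have norm_u: "norm u \<le> sqrt c"
    proof -
      have "(norm u)\<^sup>2 \<le> c * (norm w0)\<^sup>2"
        unfolding u_def by (rule c_attained) (use E0 in blast)
      also have "\<dots> \<le> c * 1\<^sup>2"
        using norm_w0 c_nonneg by (intro mult_left_mono power_mono) simp_all
      finally show ?thesis by (simp add: real_le_rsqrt)
    qed
    have Ka: "K *v a = transpose A *v u" unfolding a_def u_def by (rule K_Z_on_E[OF E0])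
    have yKa: "y \<bullet> (K *v a) = (A *v x) \<bullet> u"
      unfolding Ka using inner_transpose_mult[of A u y] Ay by (simp only: inner_commute)
    have aKa: "a \<bullet> (K *v a) = 0" "b \<bullet> (K *v a) = 0" "b \<bullet> (K *v b) = w1 \<bullet> (S *v w1)"
      by (simp_all add: a_def b_def S0 flip: inner_S)
    have K_comm: "p \<bullet> (K *v q) = q \<bullet> (K *v p)" for p q
      using symmetric_inner_mult[OF transpose_K, of p q] by (simp add: inner_commute)
    define s where "s = norm (A *v x)"
    define p where "p = norm w1"
    \<comment> \<open>The \<open>a\<close>-\<open>a\<close> and \<open>a\<close>-\<open>b\<close>
      terms drop out because \<open>S *v w0 = 0\<close>.\<close>
    have expand: "x \<bullet> (K *v x) =
        w1 \<bullet> (S *v w1) + y \<bullet> (K *v y) + 2 * ((A *v x) \<bullet> u) + 2 * (y \<bullet> (K *v b))"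
      using K_comm[of a y] K_comm[of a b] K_comm[of b y] aKa yKa
      by (simp add: x_eq matrix_vector_right_distrib inner_add_left inner_add_right)
    have y_le: "norm y \<le> L * s" unfolding y_def s_def by (rule L)
    have "\<bar>y \<bullet> (K *v b)\<bar> \<le> norm y * norm (K *v b)" by (rule Cauchy_Schwarz_ineq2)
    also have "\<dots> \<le> (L * s) * (\<kappa> * p)"
      using y_le \<kappa>(2)[of b] L by (intro mult_mono) (simp_all add: b_def p_def norm_Z s_def)
    finally have 1: "- (L * s * (\<kappa> * p)) \<le> y \<bullet> (K *v b)" by linarith
    have "\<bar>y \<bullet> (K *v y)\<bar> \<le> norm y * norm (K *v y)" by (rule Cauchy_Schwarz_ineq2)
    also have "\<dots> \<le> norm y * (\<kappa> * norm y)" using \<kappa>(2)[of y] by (rule mult_left_mono) simp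
    also have "\<dots> = \<kappa> * (norm y)\<^sup>2" by (simp add: power2_eq_square)
    also have "\<dots> \<le> \<kappa> * (L * s)\<^sup>2" using y_le \<kappa>(1) by (intro mult_left_mono power_mono) simp_all
    finally have 2: "- (\<kappa> * (L * s)\<^sup>2) \<le> y \<bullet> (K *v y)" by linarith
    have "\<bar>(A *v x) \<bullet> u\<bar> \<le> s * norm u" unfolding s_def by (rule Cauchy_Schwarz_ineq2)
    also have "\<dots> \<le> s * sqrt c" using norm_u by (rule mult_left_mono) (simp add: s_def)
    finally have 3: "- (s * sqrt c) \<le> (A *v x) \<bullet> u" by linarith
    \<comment> \<open>The penalty weight left over for the linear term in \<open>u\<close>. One
      square is completed in \<open>p\<close> with weight \<gamma>, a second in \<open>s\<close>
      with weight \<open>d\<close>; the latter leaves the remainder \<open>c / d\<close>.\<close>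
    define d where "d = \<rho> - M"
    have d: "d > 0" using \<rho> by (simp add: d_def)
    have "0 \<le> (\<gamma> * p - L * \<kappa> * s)\<^sup>2 / \<gamma>" using \<gamma> by simp
    also have "\<dots> = \<gamma> * p\<^sup>2 - 2 * (L * s * (\<kappa> * p)) + (L * \<kappa>)\<^sup>2 / \<gamma> * s\<^sup>2"
      using \<gamma> by (simp add: power2_eq_square field_simps)
    finally have 4: "- ((L * \<kappa>)\<^sup>2 / \<gamma> * s\<^sup>2) \<le> \<gamma> * p\<^sup>2 - 2 * (L * s * (\<kappa> * p))" by linarith
    have "0 \<le> (d * s - sqrt c)\<^sup>2 / d" using d by simp
    also have "\<dots> = d * s\<^sup>2 - 2 * (s * sqrt c) + (sqrt c)\<^sup>2 / d"
      using d by (simp add: power2_eq_square field_simps)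
    finally have 5: "- (c / d) \<le> d * s\<^sup>2 - 2 * (s * sqrt c)" using c_nonneg by simp
    have "d * s\<^sup>2 = \<rho> * s\<^sup>2 - \<kappa> * (L * s)\<^sup>2 - (L * \<kappa>)\<^sup>2 / \<gamma> * s\<^sup>2"
      by (simp add: d_def M_def algebra_simps power_mult_distrib)
    then have "- (c / d) \<le> f \<rho> - lam"
      using 1 2 3 4 5 gap1 expand x(2) unfolding p_def[symmetric] s_def[symmetric] by linarith
    then show "lam - f \<rho> \<le> c / (\<rho> - M)" by (simp add: d_def)
  qed
qed

text \<open>For \<open>c = 0\<close> the lower bound on \<open>f\<close> meets the upper bound
  \<open>lam\<close> as soon as \<rho> exceeds \<open>M\<close>.\<close>

lemma penalized_eq_lam:
  assumes "c = 0"
  shows "\<exists>\<rho>0\<ge>0. \<forall>\<rho>\<ge>\<rho>0. f \<rho> = lam"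
proof -
  obtain M where M: "M > 0" "\<And>\<rho>. M < \<rho> \<Longrightarrow> lam - f \<rho> \<le> c / (\<rho> - M)"
    using penalized_lower_bound by metis
  have "f \<rho> = lam" if "M + 1 \<le> \<rho>" for \<rho>
    using M(2)[of \<rho>] penalized_le_lam[of \<rho>] that assms by simp
  then show ?thesis using M(1) by (intro exI[of _ "M + 1"]) simp
qed

lemma attain_a_iff_c_eq_0: "attain_a H A Z \<longleftrightarrow> c = 0"
proof
  assume "c = 0"
  then show "attain_a H A Z" unfolding attain_a_def using penalized_eq_lam by blast
qed (simp add: attain_a_imp_attain_b flip: attain_b_iff_c_eq_0)

text \<open>The trial vector \<open>Z *v w - T *v (C *v w) /\<^sub>R \<rho>\<close> is the minimiser to first order in \<open>1 / \<rho>\<close>.\<close>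

lemma penalized_upper_bound:
  obtains B where "B \<ge> 0" "\<And>\<rho>. 0 < \<rho> \<Longrightarrow> c / \<rho> - B / \<rho>\<^sup>2 \<le> lam - f \<rho>"
proof -
  obtain w where w: "w \<in> E" "norm w = 1" "c = (norm (C *v w))\<^sup>2" by (rule c_attained)
  define a where "a = Z *v w"
  define y where "y = T *v (C *v w)"
  have Ay: "A *v y = C *v w" by (simp add: y_def)
  have yKa: "y \<bullet> (K *v a) = c"
    using inner_transpose_mult[of A "C *v w" y]
    by (simp only: a_def K_Z_on_E[OF w(1)] Ay inner_commute[of y] w(3) dot_square_norm)
  have aKy: "a \<bullet> (K *v y) = c"
    using symmetric_inner_mult[OF transpose_K, of a y] yKa by (simp add: inner_commute)
  have aKa: "a \<bullet> (K *v a) = 0" unfolding a_def by (rule K_form_on_E[OF w(1)])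
  have ya: "y \<bullet> a = 0" "a \<bullet> y = 0" using inner_T_Z[of "C *v w" w] by (simp_all add: y_def a_def inner_commute)
  have aa: "a \<bullet> a = 1" using w(2) by (simp add: a_def norm_Z dot_square_norm)
  \<comment> \<open>Collects the second-order terms, the last coming from the trial vector's norm
    exceeding 1. Monotonicity replaces \<open>f \<rho>\<close> by \<open>f 0\<close>, so
    \<open>B\<close> does not depend on \<rho>.\<close>
  define B where "B = \<bar>y \<bullet> (K *v y)\<bar> + (lam - f 0) * (norm y)\<^sup>2"
  show thesis
  proof (rule that)
    show "B \<ge> 0" using penalized_le_lam[of 0] by (simp add: B_def)
  next
    fix \<rho> :: real assume \<rho>: "0 < \<rho>"
    \<comment> \<open>This step length minimises the leading part
      \<open>- 2 * t * c + \<rho> * t\<^sup>2 * c\<close>, with value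
      \<open>- c / \<rho>\<close>.\<close>
    define t where "t = 1 / \<rho>"
    define x where "x = a - t *\<^sub>R y"
    have "A *v x = - t *\<^sub>R (C *v w)"
      by (simp add: x_def matrix_vector_mult_diff_distrib matrix_vector_mult_scaleR Ay a_def)
    then have Ax: "(norm (A *v x))\<^sup>2 = t\<^sup>2 * c" by (simp add: power_mult_distrib w(3))
    have Kx: "x \<bullet> (K *v x) = - 2 * t * c + t\<^sup>2 * (y \<bullet> (K *v y))"
      by (simp add: x_def aKa aKy yKa power2_eq_square algebra_simps)
    have "x \<bullet> x = 1 + t\<^sup>2 * (y \<bullet> y)"
      by (simp add: x_def inner_diff_left inner_diff_right ya aa power2_eq_square)
    then have nx: "(norm x)\<^sup>2 = 1 + t\<^sup>2 * (norm y)\<^sup>2" by (simp add: dot_square_norm)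
    have "(f \<rho> - lam) * (1 + t\<^sup>2 * (norm y)\<^sup>2) \<le> - 2 * t * c + t\<^sup>2 * (y \<bullet> (K *v y)) + \<rho> * (t\<^sup>2 * c)"
      using penalized_le[of \<rho> x] unfolding Ax Kx nx .
    also have "\<rho> * (t\<^sup>2 * c) = t * c" using \<rho> by (simp add: t_def power2_eq_square)
    finally have "t * c \<le> (lam - f \<rho>) + t\<^sup>2 * ((lam - f \<rho>) * (norm y)\<^sup>2) + t\<^sup>2 * (y \<bullet> (K *v y))"
      by (simp add: algebra_simps)
    moreover have "t\<^sup>2 * ((lam - f \<rho>) * (norm y)\<^sup>2) \<le> t\<^sup>2 * ((lam - f 0) * (norm y)\<^sup>2)"
      using monoD[OF mono_penalized, of 0 \<rho>] \<rho> by (intro mult_left_mono mult_right_mono) simp_all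
    moreover have "t\<^sup>2 * (y \<bullet> (K *v y)) \<le> t\<^sup>2 * \<bar>y \<bullet> (K *v y)\<bar>" by (intro mult_left_mono) simp_all
    ultimately have "t * c - t\<^sup>2 * B \<le> lam - f \<rho>" unfolding B_def distrib_left by linarith
    then show "c / \<rho> - B / \<rho>\<^sup>2 \<le> lam - f \<rho>" by (simp add: t_def power_one_over)
  qed
qed

section \<open>Asymptotics for large \<rho> and the dichotomy\<close>

lemma penalized_tendsto: "(f \<longlongrightarrow> lam) at_top"
proof -
  obtain M where M: "\<And>\<rho>. M < \<rho> \<Longrightarrow> lam - f \<rho> \<le> c / (\<rho> - M)"
    using penalized_lower_bound by metis
  have "filterlim (\<lambda>\<rho>::real. - M + \<rho>) at_top at_top"
    by (intro filterlim_tendsto_add_at_top[OF tendsto_const] filterlim_ident)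
  then have "((\<lambda>\<rho>. c / (- M + \<rho>)) \<longlongrightarrow> 0) at_top"
    by (intro tendsto_divide_0[OF tendsto_const] filterlim_at_top_imp_at_infinity)
  then have lim: "((\<lambda>\<rho>. lam - c / (- M + \<rho>)) \<longlongrightarrow> lam) at_top"
    using tendsto_diff[OF tendsto_const] by fastforce
  show ?thesis
  proof (rule tendsto_sandwich[OF _ _ lim tendsto_const])
    show "\<forall>\<^sub>F \<rho> in at_top. lam - c / (- M + \<rho>) \<le> f \<rho>"
      using eventually_gt_at_top[of M]
    proof eventually_elim
      case (elim \<rho>)
      then show ?case using M[of \<rho>] by simp
    qed
    show "\<forall>\<^sub>F \<rho> in at_top. f \<rho> \<le> lam" by (simp add: penalized_le_lam)
  qed
qed

text \<open>Both bounds on \<open>lam - f \<rho>\<close> differ from \<open>c / \<rho>\<close> by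
  terms of order \<open>1 / \<rho>\<^sup>2\<close>.\<close>

lemma penalized_expansion: "(\<lambda>\<rho>. (lam - f \<rho>) - c / \<rho>) \<in> O[at_top](\<lambda>\<rho>. 1 / \<rho>\<^sup>2)"
proof -
  obtain M where M: "M > 0" "\<And>\<rho>. M < \<rho> \<Longrightarrow> lam - f \<rho> \<le> c / (\<rho> - M)"
    using penalized_lower_bound by metis
  obtain B where B: "B \<ge> 0" "\<And>\<rho>. 0 < \<rho> \<Longrightarrow> c / \<rho> - B / \<rho>\<^sup>2 \<le> lam - f \<rho>"
    using penalized_upper_bound by metis
  show ?thesis
  proof (rule bigoI)
    show "\<forall>\<^sub>F \<rho> in at_top. norm ((lam - f \<rho>) - c / \<rho>) \<le> (B + 2 * c * M) * norm (1 / \<rho>\<^sup>2)"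
      \<comment> \<open>Beyond this threshold \<open>\<rho> - M\<close> is at least
        \<open>\<rho> / 2\<close>, whence the factor 2 in the constant.\<close>
      using eventually_ge_at_top[of "2 * M"]
    proof eventually_elim
      case (elim \<rho>)
      then have \<rho>: "0 < \<rho>" "M < \<rho>" "\<rho> \<le> 2 * (\<rho> - M)" using M(1) by (simp_all add: right_diff_distrib)
      have "c / (\<rho> - M) - c / \<rho> = c * M / (\<rho> * (\<rho> - M))" using \<rho> by (simp add: field_simps)
      also have "\<dots> \<le> c * M / (\<rho> * (\<rho> / 2))"
        using \<rho> M(1) c_nonneg by (intro divide_left_mono mult_left_mono mult_nonneg_nonneg mult_pos_pos) simp_all
      also have "\<dots> = 2 * c * M / \<rho>\<^sup>2" by (simp add: power2_eq_square)
      finally have up: "(lam - f \<rho>) - c / \<rho> \<le> 2 * c * M / \<rho>\<^sup>2" using M(2)[OF \<rho>(2)] by linarith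
      have lo: "- (B / \<rho>\<^sup>2) \<le> (lam - f \<rho>) - c / \<rho>" using B(2)[OF \<rho>(1)] by linarith
      have "0 \<le> B / \<rho>\<^sup>2" "0 \<le> 2 * c * M / \<rho>\<^sup>2" using B(1) M(1) c_nonneg by simp_all
      then have "\<bar>(lam - f \<rho>) - c / \<rho>\<bar> \<le> B / \<rho>\<^sup>2 + 2 * c * M / \<rho>\<^sup>2" using up lo by linarith
      then show ?case by (simp add: add_divide_distrib)
    qed
  qed
qed

lemma penalized_less_lam:
  assumes "c \<noteq> 0"
  shows "f \<rho> < lam"
  using assms penalized_le_lam[of \<rho>] attain_a_iff_c_eq_0 by (auto simp: attain_a_def less_le)

end

theorem corollary3p7:
  fixes H :: "real^'n^'n" and A :: "real^'n^'m" and Z :: "real^'k^'n"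
    and f :: "real \<Rightarrow> real" and lam c :: real
  assumes sym: "transpose H = H"
    and full_row_rank: "rank A = CARD('m)"
    and m_less_n: "CARD('m) < CARD('n)"
    and dim_Z: "CARD('k) = CARD('n) - CARD('m)"
    and Z_orth: "orthonormal_columns Z"
    and Z_span: "span (columns Z) = null_space A"
  defines "f \<equiv> penalized H A"
    and "lam \<equiv> lambda_star H Z"
    and "c \<equiv> c_coeff H A Z"
  shows
    "(attain_a H A Z \<longleftrightarrow> attain_b H Z) \<and> (attain_b H Z \<longleftrightarrow> attain_c H Z) \<and>
     (attain_a H A Z \<longleftrightarrow> c = 0) \<and> (\<not> attain_a H A Z \<longleftrightarrow> c > 0) \<and>
     ((attain_a H A Z \<and> attain_b H Z \<and> attain_c H Z \<and> c = 0 \<and>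
         (\<exists>\<rho>0\<ge>0. \<forall>\<rho>\<ge>\<rho>0. f \<rho> = lam))
      \<longleftrightarrow>
      \<not> (\<not> attain_a H A Z \<and> \<not> attain_b H Z \<and> \<not> attain_c H Z \<and> c > 0 \<and>
         (\<forall>\<rho>. f \<rho> < lam) \<and> strict_mono f \<and> increases_to f lam \<and>
         (\<lambda>\<rho>. (lam - f \<rho>) - c / \<rho>) \<in> O[at_top](\<lambda>\<rho>. 1 / \<rho>\<^sup>2))) \<and>
     (lam = 0 \<longrightarrow>
        ((\<forall>\<^sub>F \<rho> in at_top. f \<rho> = 0)
         \<longleftrightarrow>
         \<not> ((\<forall>\<rho>. f \<rho> < 0) \<and> c > 0 \<and>
            (\<lambda>\<rho>. f \<rho> - (- c / \<rho>)) \<in> O[at_top](\<lambda>\<rho>. 1 / \<rho>\<^sup>2))))"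
proof -
  interpret penalized_eigenproblem H A Z
    using sym full_row_rank Z_orth Z_span by unfold_locales
  have ab: "attain_a H A Z \<longleftrightarrow> c = 0" "attain_b H Z \<longleftrightarrow> c = 0" "attain_c H Z \<longleftrightarrow> c = 0"
    unfolding c_def using attain_a_iff_c_eq_0 attain_b_iff_c_eq_0 attain_b_iff_attain_c by auto
  have c0: "c \<ge> 0" unfolding c_def by (rule c_nonneg)
  show ?thesis
  \<comment> \<open>"Exactly one" is stated as one alternative being equivalent to the negation of
    the other, so each case proves its own alternative and refutes the other.\<close>
  proof (cases "c = 0")
    case True
    have ex: "\<exists>\<rho>0\<ge>0. \<forall>\<rho>\<ge>\<rho>0. f \<rho> = lam"
      using penalized_eq_lam True unfolding c_def f_def lam_def by blast
    then have "\<forall>\<^sub>F \<rho> in at_top. f \<rho> = lam" by (auto simp: eventually_at_top_linorder)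
    then show ?thesis using ab True ex by auto
  next
    case False
    then have pos: "c > 0" using c0 by simp
    have less: "\<forall>\<rho>. f \<rho> < lam"
      using penalized_less_lam False unfolding c_def f_def lam_def by blast
    have strict: "strict_mono f"
      using strict_mono_penalized less unfolding f_def lam_def by blast
    have inc: "increases_to f lam"
      using mono_penalized penalized_le_lam penalized_tendsto
      unfolding increases_to_def f_def lam_def by blast
    have O: "(\<lambda>\<rho>. (lam - f \<rho>) - c / \<rho>) \<in> O[at_top](\<lambda>\<rho>. 1 / \<rho>\<^sup>2)"
      unfolding c_def f_def lam_def by (rule penalized_expansion)
    have "(\<lambda>\<rho>. f \<rho> - (- c / \<rho>)) \<in> O[at_top](\<lambda>\<rho>. 1 / \<rho>\<^sup>2)" if "lam = 0"
    proof -
      have "(\<lambda>\<rho>. f \<rho> - (- c / \<rho>)) = (\<lambda>\<rho>. - ((lam - f \<rho>) - c / \<rho>))" using that by auto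
      then show ?thesis using O by (simp only: landau_o.big.uminus_in_iff)
    qed
    \<comment> \<open>The first alternative for \<open>lam = 0\<close> does not mention
      \<open>c\<close>, so it is refuted through the strict inequality.\<close>
    moreover have "\<not> (\<forall>\<^sub>F \<rho> in at_top. f \<rho> = 0)" if "lam = 0"
    proof
      assume "\<forall>\<^sub>F \<rho> in at_top. f \<rho> = 0"
      then obtain \<rho> where "f \<rho> = 0" by (auto simp: eventually_at_top_linorder)
      then show False using less that by (metis less_irrefl)
    qed
    ultimately show ?thesis using ab pos less strict inc O by auto
  qed
qed

end
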